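(* Let $\Omega\subseteq\mathbb{O}$ be either a slice domain or a product domain and let $f:\Omega\to\mathbb{O}$ be a slice regular function. If $f$ is not slice constant, then $f$ is quasi-open.
   Context: $\mathbb{O}$ is the real algebra of octonions, identified with $\mathbb{R}^8$; $\mathbb{S}=\{J\in\mathbb{O}: J^2=-1\}$ (a $6$-sphere); for $J\in\mathbb{S}$, $\mathbb{C}_J=\mathbb{R}+J\mathbb{R}$. Circular sets. For a nonempty $D\subseteq\mathbb{C}$ invariant under complex conjugation, $\Omega_D=\{\alpha+\beta J:\alpha,\beta\in\mathbb{R},\ \alpha+i\beta\in D,\ J\in\mathbb{S}\}$. Write $\Omega=\Omega_D$ and $\Omega_J=\Omega\cap\mathbb{C}_J$. When $D$ is open, $\Omega_D$ is a slice domain if $D$ is connected and meets $\mathbb{R}$; it is a product domain if $D\cap\mathbb{R}=\emptyset$ and $D$ has exactly two connected components, switched by complex conjugation. Slice regular functions. Let $\mathbb{O}_{\mathbb{C}}=\mathbb{O}\otimes_{\mathbb{R}}\mathbb{C}=\{x+\imath y: x,y\in\mathbb{O}\}$ with $\overline{x+\imath y}=x-\imath y$. A stem function is a map $F=F_1+\imath F_2:D\to\mathbb{O}_{\mathbb{C}}$ with $F(\bar z)=\overline{F(z)}$; it induces the slice function $f:\Omega_D\to\mathbb{O}$, $f(\alpha+\beta J)=F_1(\alpha+i\beta)+JF_2(\alpha+i\beta)$. If $\Omega_D$ is open, $f$ is slice regular when $F$ is continuously differentiable and $\frac{\partial F}{\partial\alpha}+\imath\frac{\partial F}{\partial\beta}\equiv0$.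 A slice regular $f$ is slice constant if $f_{|\Omega_J}$ is locally constant for each $J\in\mathbb{S}$. A map $f:A\to B$ between topological spaces is quasi-open if, for each $b\in B$ and each open neighborhood $U$ in $A$ of a compact connected component of $f^{-1}(b)$, the point $b$ belongs to the interior of $f(U)$. *)

theory Defs
  imports "HOL-Analysis.Analysis"
begin

section \<open>Octonions\<close>

text \<open>The algebra is built by two Cayley-Dickson doublings of the complex numbers. The underlying
  type of nested pairs already carries the Euclidean structure of the 8-dimensional real space:
  addition, real scaling, norm and topology are those of the product instances.\<close>

type_synonym quat = "complex \<times> complex"
type_synonym oct = "quat \<times> quat"

fun qmult :: "quat \<Rightarrow> quat \<Rightarrow> quat" where
  "qmult (a, b) (c, d) = (a * c - cnj d * b, d * a + b * cnj c)"

fun qcnj :: "quat \<Rightarrow> quat" where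
  "qcnj (a, b) = (cnj a, - b)"

fun omult :: "oct \<Rightarrow> oct \<Rightarrow> oct"  (infixl "\<cdot>\<^sub>O" 70) where
  "omult (a, b) (c, d) = (qmult a c - qmult (qcnj d) b, qmult d a + qmult b (qcnj c))"

definition oone :: oct where
  "oone = ((1, 0), (0, 0))"

lemma omult_oone [simp]: "oone \<cdot>\<^sub>O x = x" "x \<cdot>\<^sub>O oone = x"
  by (cases x; cases "fst x"; cases "snd x"; simp add: oone_def)+

lemma bilinear_omult: "bilinear (\<cdot>\<^sub>O)"
  unfolding bilinear_def
  by (auto intro!: linearI simp: algebra_simps scaleR_conv_of_real)

lemma norm_omult: "norm (x \<cdot>\<^sub>O y) = norm x * norm y"
proof -
  obtain a b c d where x: "x = ((a, b), (c, d))" by (metis surj_pair)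
  obtain a' b' c' d' where y: "y = ((a', b'), (c', d'))" by (metis surj_pair)
  have "(norm (x \<cdot>\<^sub>O y))\<^sup>2 = (norm x * norm y)\<^sup>2"
    unfolding x y
    by (simp add: norm_Pair power_mult_distrib cmod_power2) algebra
  thus ?thesis
    by (simp add: power2_eq_iff_nonneg)
qed

definition imag_units :: "oct set" where
  "imag_units = {J. J \<cdot>\<^sub>O J = - oone}"

definition slice_plane :: "oct \<Rightarrow> oct set" where
  "slice_plane J = {\<alpha> *\<^sub>R oone + \<beta> *\<^sub>R J | \<alpha> \<beta>. True}"


section \<open>Circular sets\<close>

definition circularization :: "complex set \<Rightarrow> oct set" where
  "circularization D = {\<alpha> *\<^sub>R oone + \<beta> *\<^sub>R J | \<alpha> \<beta> J. Complex \<alpha> \<beta> \<in> D \<and> J \<in> imag_units}"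

definition circular_domain_base :: "complex set \<Rightarrow> bool" where
  "circular_domain_base D \<longleftrightarrow> D \<noteq> {} \<and> open D \<and> cnj ` D = D"

definition is_slice_domain :: "oct set \<Rightarrow> bool" where
  "is_slice_domain \<Omega> \<longleftrightarrow> (\<exists>D. circular_domain_base D \<and> \<Omega> = circularization D \<and>
     connected D \<and> D \<inter> \<real> \<noteq> {})"

definition is_product_domain :: "oct set \<Rightarrow> bool" where
  "is_product_domain \<Omega> \<longleftrightarrow> (\<exists>D. circular_domain_base D \<and> \<Omega> = circularization D \<and>
     D \<inter> \<real> = {} \<and> (\<exists>C C'. components D = {C, C'} \<and> C \<noteq> C' \<and> cnj ` C = C' \<and> cnj ` C' = C))"


section \<open>Stem functions and slice regular functions\<close>

text \<open>An element \<open>x + \<iota> y\<close> of the complexified octonions is the pair \<open>(x, y)\<close>.\<close>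

type_synonym octC = "oct \<times> oct"

definition octC_cnj :: "octC \<Rightarrow> octC" where
  "octC_cnj w = (fst w, - snd w)"

definition octC_iota :: "octC \<Rightarrow> octC" where
  "octC_iota w = (- snd w, fst w)"

definition is_stem :: "complex set \<Rightarrow> (complex \<Rightarrow> octC) \<Rightarrow> bool" where
  "is_stem D F \<longleftrightarrow> (\<forall>z\<in>D. F (cnj z) = octC_cnj (F z))"

definition induces :: "complex set \<Rightarrow> (complex \<Rightarrow> octC) \<Rightarrow> (oct \<Rightarrow> oct) \<Rightarrow> bool" where
  "induces D F f \<longleftrightarrow> (\<forall>\<alpha> \<beta>. \<forall>J\<in>imag_units. Complex \<alpha> \<beta> \<in> D \<longrightarrow>
     f (\<alpha> *\<^sub>R oone + \<beta> *\<^sub>R J) = fst (F (Complex \<alpha> \<beta>)) + J \<cdot>\<^sub>O snd (F (Complex \<alpha> \<beta>)))"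

definition continuously_differentiable_on ::
    "('a::real_normed_vector \<Rightarrow> 'b::real_normed_vector) \<Rightarrow> 'a set \<Rightarrow> bool" where
  "continuously_differentiable_on F D \<longleftrightarrow> (\<exists>F' :: 'a \<Rightarrow> 'a \<Rightarrow>\<^sub>L 'b.
     (\<forall>z\<in>D. (F has_derivative blinfun_apply (F' z)) (at z)) \<and> continuous_on D F')"

definition partial_alpha :: "(complex \<Rightarrow> octC) \<Rightarrow> complex \<Rightarrow> octC" where
  "partial_alpha F z = vector_derivative (\<lambda>t. F (Complex t (Im z))) (at (Re z))"

definition partial_beta :: "(complex \<Rightarrow> octC) \<Rightarrow> complex \<Rightarrow> octC" where
  "partial_beta F z = vector_derivative (\<lambda>t. F (Complex (Re z) t)) (at (Im z))"

text \<open>Functions on \<open>\<Omega>\<close> are represented by total functions whose values outside \<open>\<Omega>\<close> are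
  irrelevant. The base \<open>D\<close> is uniquely determined by \<open>\<Omega>\<close>.\<close>

definition slice_regular_on :: "oct set \<Rightarrow> (oct \<Rightarrow> oct) \<Rightarrow> bool" where
  "slice_regular_on \<Omega> f \<longleftrightarrow> (\<exists>D F. circular_domain_base D \<and> \<Omega> = circularization D \<and>
     is_stem D F \<and> induces D F f \<and> continuously_differentiable_on F D \<and>
     (\<forall>z\<in>D. partial_alpha F z + octC_iota (partial_beta F z) = 0))"

definition slice_constant_on :: "oct set \<Rightarrow> (oct \<Rightarrow> oct) \<Rightarrow> bool" where
  "slice_constant_on \<Omega> f \<longleftrightarrow>
     (\<forall>J\<in>imag_units. locally (\<lambda>V. f constant_on V) (\<Omega> \<inter> slice_plane J))"


section \<open>Quasi-open maps\<close>

definition quasi_open_map :: "'a topology \<Rightarrow> 'b topology \<Rightarrow> ('a \<Rightarrow> 'b) \<Rightarrow> bool" where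
  "quasi_open_map X Y f \<longleftrightarrow> f \<in> topspace X \<rightarrow> topspace Y \<and>
     (\<forall>b \<in> topspace Y. \<forall>K \<in> connected_components_of (subtopology X {x \<in> topspace X. f x = b}).
        compactin X K \<longrightarrow> (\<forall>U. openin X U \<and> K \<subseteq> U \<longrightarrow> b \<in> Y interior_of (f ` U)))"

end

(* For y in the octonions let N_y(z) be the sum of the squares of the complexified coordinates of
   F(z) - y, where F is the stem function of f. N_y is holomorphic, and N_y(z) = 0 holds exactly
   when f takes the value y on the sphere over z. If N_b is not identically zero, Hurwitz's theorem
   gives zeros of N_y near those of N_b for y near b, and compactness of the sphere of imaginary
   units turns these into preimages of y close to the fibre of f over b. If N_b is identically
   zero, then F = b at the real points of D, so a slice domain is impossible; on a product domain
   the fibre over b contains a connected graph over a dense subset of the upper half of D, which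
   every component of the fibre must contain, and so no component is compact. *)

theory Submission
  imports Defs "HOL-Complex_Analysis.Complex_Analysis"
begin

section \<open>Octonion identities and the 6-sphere of imaginary units\<close>

section \<open>Octonions and their imaginary units\<close>

lemma oone_inner:
  "x \<bullet> oone = Re (fst (fst x))" by (simp add: oone_def inner_prod_def inner_complex_def)

lemma norm_oct_squared:
  "(norm ((a, b), (c, d)))\<^sup>2 = (Re a)\<^sup>2 + (Im a)\<^sup>2 + ((Re b)\<^sup>2 + (Im b)\<^sup>2) +
     ((Re c)\<^sup>2 + (Im c)\<^sup>2 + ((Re d)\<^sup>2 + (Im d)\<^sup>2))"
  by (simp add: norm_Pair cmod_power2)

text \<open>The quadratic equation x^2 - 2 Re(x) x + |x|^2 = 0 satisfied by every octonion; it
  identifies the imaginary units as the purely imaginary elements of norm 1.\<close>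

lemma omult_self:
  "x \<cdot>\<^sub>O x = (2 * (x \<bullet> oone)) *\<^sub>R x - (norm x)\<^sup>2 *\<^sub>R oone"
proof -
  obtain a b c d where x: "x = ((a, b), (c, d))" by (metis surj_pair)
  show ?thesis unfolding x oone_inner norm_oct_squared
    by (auto simp: oone_def complex_eq_iff algebra_simps power2_eq_square)
qed

lemma inner_omult_right: "(x \<cdot>\<^sub>O y) \<bullet> y = (x \<bullet> oone) * (norm y)\<^sup>2"
proof -
  obtain a b c d where x: "x = ((a, b), (c, d))" by (metis surj_pair)
  obtain a' b' c' d' where y: "y = ((a', b'), (c', d'))" by (metis surj_pair)
  show ?thesis unfolding x y oone_inner norm_oct_squared
    by (simp add: inner_complex_def algebra_simps power2_eq_square)
qed

text \<open>Octonion conjugation, written through the real part rather than by coordinates so that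
  continuity follows from that of the inner product.\<close>

definition ocnj :: "oct \<Rightarrow> oct" where "ocnj x = (2 * (x \<bullet> oone)) *\<^sub>R oone - x"

lemma ocnj_eq: "ocnj ((a,b),(c,d)) = ((cnj a,-b),(-c,-d))"
  by (simp add: ocnj_def oone_inner oone_def complex_eq_iff)

lemma norm_ocnj: "norm (ocnj x) = norm x"
proof -
  obtain a b c d where x: "x = ((a, b), (c, d))" by (metis surj_pair)
  show ?thesis unfolding x ocnj_eq by (simp add: norm_Pair)
qed

text \<open>An instance of alternativity that replaces associativity: it makes x *
  \<open>ocnj y\<close> / |y|^2 a genuine right quotient of x by y. The proof is a coordinate
  computation.\<close>

lemma omult_ocnj_cancel:
  "(x \<cdot>\<^sub>O ocnj y) \<cdot>\<^sub>O y = (norm y)\<^sup>2 *\<^sub>R x"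
proof -
  obtain a b c d where x: "x = ((a, b), (c, d))" by (metis surj_pair)
  obtain a' b' c' d' where y: "y = ((a', b'), (c', d'))" by (metis surj_pair)
  show ?thesis unfolding x y ocnj_eq norm_oct_squared
    by (simp add: complex_eq_iff algebra_simps power2_eq_square)
qed

lemma omult_ocnj_inner: "(x \<cdot>\<^sub>O ocnj y) \<bullet> oone = x \<bullet> y"
proof -
  obtain a b c d where x: "x = ((a, b), (c, d))" by (metis surj_pair)
  obtain a' b' c' d' where y: "y = ((a', b'), (c', d'))" by (metis surj_pair)
  show ?thesis unfolding x y ocnj_eq oone_inner
    by (simp add: inner_complex_def algebra_simps)
qed

lemma imag_units_iff:
  "J \<in> imag_units \<longleftrightarrow> J \<bullet> oone = 0 \<and> norm J = 1"
proof
  assume "J \<in> imag_units"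
  then have J: "J \<cdot>\<^sub>O J = - oone" by (simp add: imag_units_def)
  have "norm oone = 1" by (simp add: oone_def norm_Pair)
  then have "(norm J)\<^sup>2 = 1"
    using norm_omult[of J J] by (simp add: J power2_eq_square)
  then have n: "norm J = 1" by (simp add: power2_eq_1_iff) (use norm_ge_zero[of J] in linarith)
  have "(2 * (J \<bullet> oone)) *\<^sub>R J = 0"
    using omult_self[of J] by (simp add: J n)
  then show "J \<bullet> oone = 0 \<and> norm J = 1" using n by auto
next
  assume "J \<bullet> oone = 0 \<and> norm J = 1"
  then show "J \<in> imag_units" using omult_self[of J] by (simp add: imag_units_def)
qed

lemma i_in_imag_units: "((\<i>, 0), (0, 0)) \<in> imag_units"
  by (simp add: imag_units_def oone_def)

lemma imag_units_nonempty: "imag_units \<noteq> {}"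
  using i_in_imag_units by blast

text \<open>Dropping the zero real part leaves the unit sphere of a 7-dimensional space, from which
  compactness and connectedness are transported.\<close>

lemma imag_units_eq_image:
  "imag_units = (\<lambda>(t, b, c, d). ((Complex 0 t, b), (c, d))) `
     sphere (0 :: real \<times> complex \<times> complex \<times> complex) 1"
  (is "_ = ?h ` _")
proof (intro subset_antisym subsetI)
  fix x assume "x \<in> ?h ` sphere 0 1"
  then obtain t b c d where "x = ?h (t, b, c, d)" "norm (t, b, c, d) = 1" by auto
  then show "x \<in> imag_units"
    by (simp add: imag_units_iff oone_inner norm_Pair cmod_power2 algebra_simps)
next
  fix x assume x: "x \<in> imag_units"
  obtain a b c d where eq: "x = ((a, b), (c, d))" by (metis surj_pair)
  have "a = Complex 0 (Im a)" "norm a = \<bar>Im a\<bar>" "norm ((a, b), (c, d)) = 1"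
    using x by (auto simp: eq imag_units_iff oone_inner complex_eq_iff cmod_def)
  then show "x \<in> ?h ` sphere 0 1"
    by (intro image_eqI[of _ _ "(Im a, b, c, d)"]) (auto simp: eq norm_Pair algebra_simps)
qed

lemma continuous_on_Complex_0: "continuous_on UNIV (\<lambda>(t, b, c, d). ((Complex 0 t, b), (c, d)))"
  unfolding Complex_eq case_prod_unfold by (intro continuous_intros)

lemma compact_imag_units: "compact imag_units"
  unfolding imag_units_eq_image
  by (intro compact_continuous_image continuous_on_subset[OF continuous_on_Complex_0]) auto

lemma connected_imag_units: "connected imag_units"
  unfolding imag_units_eq_image
  by (intro connected_continuous_image connected_sphere continuous_on_subset[OF continuous_on_Complex_0]) auto

interpretation omult: bounded_bilinear "(\<cdot>\<^sub>O)"
  using bilinear_omult bilinear_conv_bounded_bilinear by blast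

section \<open>A complex quadratic form detecting zeros on a sphere\<close>

section \<open>The complexified norm\<close>

text \<open>The complex-bilinear extension of the squared norm to complexified octonions, evaluated
  at w = x + iy and split into real and imaginary parts.\<close>

definition complexified_normsq :: "octC \<Rightarrow> complex" where
  "complexified_normsq w = Complex ((norm (fst w))\<^sup>2 - (norm (snd w))\<^sup>2) (2 * (fst w \<bullet> snd w))"

text \<open>In this form the value is a polynomial in the complex coordinates of w, hence
  holomorphic whenever they are.\<close>

lemma complexified_normsq_eq_sum:
  "complexified_normsq w = (\<Sum>e\<in>Basis. (Complex (fst w \<bullet> e) (snd w \<bullet> e))\<^sup>2)"
proof (rule complex_eqI)
  have *: "(norm (x::oct))\<^sup>2 = (\<Sum>e\<in>Basis. (x \<bullet> e)\<^sup>2)" for x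
    unfolding power2_norm_eq_inner euclidean_inner[of x x] by (simp add: power2_eq_square)
  show "Re (complexified_normsq w) = Re (\<Sum>e\<in>Basis. (Complex (fst w \<bullet> e) (snd w \<bullet> e))\<^sup>2)"
    by (simp add: complexified_normsq_def * sum_subtractf Re_power2)
  show "Im (complexified_normsq w) = Im (\<Sum>e\<in>Basis. (Complex (fst w \<bullet> e) (snd w \<bullet> e))\<^sup>2)"
    unfolding complexified_normsq_def euclidean_inner[of "fst w" "snd w"] by (simp add: Im_power2 sum_distrib_left mult.assoc)
qed

text \<open>For w = x + iy the only candidate is J = -x y^(-1). A zero of the form means |x| = |y|
  and x orthogonal to y; the first gives J norm 1, the second makes it purely imaginary. The
  explicit formula later gives continuity of J in w.\<close>

lemma complexified_normsq_zero_unit: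
  assumes "complexified_normsq w = 0" "snd w \<noteq> 0"
  defines "J \<equiv> (- inverse ((norm (snd w))\<^sup>2)) *\<^sub>R (fst w \<cdot>\<^sub>O ocnj (snd w))"
  shows "J \<in> imag_units" "fst w + J \<cdot>\<^sub>O snd w = 0"
proof -
  have "norm (fst w) = norm (snd w)" "fst w \<bullet> snd w = 0"
    using assms(1) by (auto simp: complexified_normsq_def complex_eq_iff)
  then show "J \<in> imag_units"
    using assms(2)
    by (simp add: imag_units_iff J_def omult_ocnj_inner norm_omult norm_ocnj field_simps power2_eq_square)
  show "fst w + J \<cdot>\<^sub>O snd w = 0"
    using assms(2) by (simp add: J_def omult.scaleR_left omult.minus_left omult_ocnj_cancel)
qed

text \<open>Forward, J is the explicit quotient, or arbitrary when w = 0. Backward, x = -Jy has the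
  norm of y and is orthogonal to y because J has real part 0.\<close>

lemma complexified_normsq_eq_0_iff:
  "complexified_normsq w = 0 \<longleftrightarrow> (\<exists>J\<in>imag_units. fst w + J \<cdot>\<^sub>O snd w = 0)"
proof
  assume w: "complexified_normsq w = 0"
  show "\<exists>J\<in>imag_units. fst w + J \<cdot>\<^sub>O snd w = 0"
  proof (cases "snd w = 0")
    case True
    moreover from this w have "fst w = 0" by (simp add: complexified_normsq_def complex_eq_iff)
    ultimately show ?thesis using imag_units_nonempty by (auto simp: omult.zero_right)
  next
    case False
    with w show ?thesis using complexified_normsq_zero_unit by blast
  qed
next
  assume "\<exists>J\<in>imag_units. fst w + J \<cdot>\<^sub>O snd w = 0"
  then obtain J where J: "J \<in> imag_units" and eq: "fst w = - (J \<cdot>\<^sub>O snd w)"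
    by (auto simp: eq_neg_iff_add_eq_0)
  show "complexified_normsq w = 0"
    using J by (simp add: complexified_normsq_def eq norm_omult inner_omult_right imag_units_iff complex_eq_iff)
qed

text \<open>Multiplicativity of the norm excludes zero divisors. This makes J unique in a fibre over
  z when \<open>snd (F z)\<close> is nonzero.\<close>

lemma omult_right_cancel:
  "y \<noteq> 0 \<Longrightarrow> x \<cdot>\<^sub>O y = z \<cdot>\<^sub>O y \<Longrightarrow> x = z"
proof -
  assume "y \<noteq> 0" "x \<cdot>\<^sub>O y = z \<cdot>\<^sub>O y"
  then have "norm ((x - z) \<cdot>\<^sub>O y) = 0" by (simp add: omult.diff_left)
  with \<open>y \<noteq> 0\<close> show "x = z" by (simp add: norm_omult)
qed

section \<open>Coordinates z and J on circular sets\<close>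

section \<open>Slice coordinates\<close>

definition slice_point :: "complex \<Rightarrow> oct \<Rightarrow> oct" where
  "slice_point z J = Re z *\<^sub>R oone + Im z *\<^sub>R J"

text \<open>Of the two conjugate choices of z for a point, this takes the one in the closed upper
  half plane, which makes it a continuous function of the point.\<close>

definition slice_coord :: "oct \<Rightarrow> complex" where
  "slice_coord x = Complex (x \<bullet> oone) (norm (x - (x \<bullet> oone) *\<^sub>R oone))"

lemma norm_oone [simp]: "norm oone = 1" and inner_oone [simp]: "oone \<bullet> oone = 1"
  by (auto simp: oone_def norm_Pair inner_prod_def)

lemma slice_coord_slice_point:
  "J \<in> imag_units \<Longrightarrow> slice_coord (slice_point z J) = Complex (Re z) \<bar>Im z\<bar>"
  by (simp add: slice_coord_def slice_point_def imag_units_iff inner_add_left)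

lemma slice_point_slice_coordE:
  obtains J where "J \<in> imag_units" "x = slice_point (slice_coord x) J"
proof (cases "x = (x \<bullet> oone) *\<^sub>R oone")
  case True
  with i_in_imag_units show ?thesis
    \<comment> \<open>At a real point the imaginary coordinate is 0, so any unit serves.\<close>
    using that[of "((\<i>, 0), (0, 0))"]
    by (simp add: slice_point_def slice_coord_def zero_prod_def flip: True)
next
  case False
  define v where "v = x - (x \<bullet> oone) *\<^sub>R oone"
  have "v \<noteq> 0" using False by (simp add: v_def)
  moreover have "v \<bullet> oone = 0" by (simp add: v_def inner_diff_left)
  ultimately have "inverse (norm v) *\<^sub>R v \<in> imag_units" by (simp add: imag_units_iff)
  moreover have "x = slice_point (slice_coord x) (inverse (norm v) *\<^sub>R v)"
    using \<open>v \<noteq> 0\<close> by (simp add: slice_point_def slice_coord_def flip: v_def) (simp add: v_def)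
  ultimately show ?thesis using that by blast
qed

lemma Im_slice_coord_nonneg: "Im (slice_coord x) \<ge> 0" by (simp add: slice_coord_def)

lemma continuous_on_slice_coord: "continuous_on S slice_coord"
  unfolding slice_coord_def[abs_def] Complex_eq by (intro continuous_intros)

lemma cnj_mem_iff:
  "cnj ` D = D \<Longrightarrow> cnj z \<in> D \<longleftrightarrow> z \<in> D"
  by (metis complex_cnj_cnj imageE imageI)

lemma mem_circularization:
  assumes "cnj ` D = D"
  shows "x \<in> circularization D \<longleftrightarrow> slice_coord x \<in> D"
proof
  assume "x \<in> circularization D"
  then obtain a b J where x: "x = slice_point (Complex a b) J" "Complex a b \<in> D" "J \<in> imag_units"
    by (auto simp: circularization_def slice_point_def)
  have "Complex a \<bar>b\<bar> = Complex a b \<or> Complex a \<bar>b\<bar> = cnj (Complex a b)"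
    by (auto simp: complex_eq_iff abs_if)
  with x show "slice_coord x \<in> D" using cnj_mem_iff[OF assms, of "Complex a b"] by (auto simp: slice_coord_slice_point)
next
  assume "slice_coord x \<in> D"
  then show "x \<in> circularization D"
    by (rule_tac slice_point_slice_coordE[of x]) (auto simp: circularization_def slice_point_def, metis complex.collapse)
qed

text \<open>The slice through one fixed unit recovers the base. Needed because the hypothesis on the
  domain and slice regularity each bring their own base.\<close>

lemma circularization_inj:
  assumes "cnj ` D = D" "cnj ` D' = D'" "circularization D = circularization D'"
  shows "D = D'"
proof -
  have "z \<in> A \<longleftrightarrow> slice_point z ((\<i>, 0), (0, 0)) \<in> circularization A" if "cnj ` A = A" for A z
  proof -
    have "Complex (Re z) \<bar>Im z\<bar> = z \<or> Complex (Re z) \<bar>Im z\<bar> = cnj z"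
      by (auto simp: complex_eq_iff abs_if)
    then show ?thesis
      using cnj_mem_iff[OF that, of z] by (auto simp: mem_circularization[OF that] slice_coord_slice_point[OF i_in_imag_units])
  qed
  from this[OF assms(1)] this[OF assms(2)] show ?thesis by (auto simp: assms(3))
qed

section \<open>Countable exceptional sets, components and sign of the imaginary part\<close>

section \<open>Topology and complex analysis\<close>

lemma uniform_limit_sum:
  fixes f :: "'i \<Rightarrow> 'n \<Rightarrow> 'x \<Rightarrow> 'b::real_normed_vector"
  assumes "\<And>i. i \<in> I \<Longrightarrow> uniform_limit S (f i) (g i) \<F>"
  shows "uniform_limit S (\<lambda>n x. \<Sum>i\<in>I. f i n x) (\<lambda>x. \<Sum>i\<in>I. g i x) \<F>"
  using assms
  by (induction I rule: infinite_finite_induct) (auto intro: uniform_limit_const uniform_limit_add)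

text \<open>A ball is uncountable, so it cannot lie inside a countable set.\<close>

lemma closure_open_diff_countable:
  fixes S :: "'a::euclidean_space set"
  assumes "open S" "countable T"
  shows "S \<subseteq> closure (S - T)"
proof
  fix x assume "x \<in> S"
  show "x \<in> closure (S - T)"
  proof (rule ccontr)
    assume "x \<notin> closure (S - T)"
    then have "x \<in> S - closure (S - T)" "open (S - closure (S - T))"
      using \<open>x \<in> S\<close> assms(1) by auto
    then obtain r where r: "r > 0" "ball x r \<subseteq> S - closure (S - T)"
      by (meson openE)
    then have "ball x r \<subseteq> T"
      using r(2) closure_subset[of "S - T"] by blast
    then show False
      using uncountable_ball[OF r(1)] assms(2) countable_subset by blast
  qed
qed

lemma countable_zeros_open:
  assumes "g holomorphic_on S" "open S" "connected S" "w \<in> S" "g w \<noteq> 0"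
  shows "countable {z \<in> S. g z = 0}"
proof (cases "g constant_on S")
  case True
  then have "{z \<in> S. g z = 0} = {}"
    using assms(4,5) by (force simp: constant_on_def)
  then show ?thesis by (simp only: countable_empty)
next
  case False
  obtain C where "\<And>n::nat. compact (C n)" "\<Union>(range C) = S"
    using open_Union_compact_subsets[OF assms(2)] by metis
  then have "fsigma S" unfolding fsigma_Union_compact by (intro exI[of _ C]) auto
  with False assms show ?thesis by (intro holomorphic_countable_zeros)
qed

lemma connected_components_of_top_of_set: "connected_components_of (top_of_set S) = components S"
  unfolding connected_components_of_def components_def connected_component_of_def connected_component_def
  by (simp add: connectedin_subtopology conj_ac)

lemma connected_avoiding_reals:
  assumes "connected S" "S \<inter> \<real> = {}"
  shows "(\<forall>z\<in>S. Im z > 0) \<or> (\<forall>z\<in>S. Im z < 0)"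
proof (rule ccontr)
  assume "\<not> ?thesis"
  then obtain z w where "z \<in> S" "Im z \<le> 0" "w \<in> S" "Im w \<ge> 0"
    by (auto simp: not_less)
  moreover have "connected (Im ` S)"
    by (intro connected_continuous_image continuous_intros assms)
  ultimately have "0 \<in> Im ` S"
    by (metis connected_iff_interval imageI)
  with assms show False by (auto simp: complex_is_Real_iff)
qed

text \<open>Continuity of the unit -x y^(-1) of \<open>complexified_normsq_zero_unit\<close> where y
  is nonzero.\<close>

lemma continuous_on_zero_unit:
  "continuous_on {w. snd w \<noteq> 0} (\<lambda>w. (- inverse ((norm (snd w))\<^sup>2)) *\<^sub>R (fst w \<cdot>\<^sub>O ocnj (snd w)))"
  unfolding ocnj_def by (intro continuous_intros omult.continuous_on) auto

section \<open>Fibres of slice regular functions\<close>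

locale slice_regular_stem =
  fixes D :: "complex set" and F :: "complex \<Rightarrow> octC" and f :: "oct \<Rightarrow> oct"
  assumes base: "circular_domain_base D"
    and stem: "is_stem D F"
    and induces: "induces D F f"
    and C1: "continuously_differentiable_on F D"
    and CR: "\<And>z. z \<in> D \<Longrightarrow> partial_alpha F z + octC_iota (partial_beta F z) = 0"
begin

section \<open>Holomorphy of the stem function\<close>

lemma open_D: "open D" and cnj_D: "cnj ` D = D"
  using base by (auto simp: circular_domain_base_def)

lemma slice_point_in_circularization:
  "z \<in> D \<Longrightarrow> J \<in> imag_units \<Longrightarrow> slice_point z J \<in> circularization D"
  unfolding circularization_def slice_point_def
  by (intro CollectI exI[of _ "Re z"] exI[of _ "Im z"] exI[of _ J]) simp

lemma f_slice_point:
  "z \<in> D \<Longrightarrow> J \<in> imag_units \<Longrightarrow> f (slice_point z J) = fst (F z) + J \<cdot>\<^sub>O snd (F z)"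
  using induces by (simp add: induces_def slice_point_def)

text \<open>Restricting the total derivative to the two coordinate lines identifies the partial
  derivatives with \<open>F' 1\<close> and \<open>F' \<i>\<close>; the Cauchy-Riemann equation then
  says that \<open>F'\<close> is complex linear for the structure \<open>octC_iota\<close>.\<close>

lemma differentiable:
  assumes "z \<in> D"
  obtains F' where "(F has_derivative F') (at z)" "F' \<i> = octC_iota (F' 1)"
proof -
  obtain F' where F': "(F has_derivative F') (at z)"
    using C1 assms by (auto simp: continuously_differentiable_on_def)
  interpret F': bounded_linear F' using F' by (rule has_derivative_bounded_linear)
  have "((\<lambda>t. Complex t (Im z)) has_vector_derivative 1) (at (Re z))"
    unfolding Complex_eq by (auto intro!: derivative_eq_intros simp: has_vector_derivative_def scaleR_conv_of_real)
  from has_derivative_compose[OF this[unfolded has_vector_derivative_def], of F F'] F'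
  have "((\<lambda>t. F (Complex t (Im z))) has_vector_derivative F' 1) (at (Re z))"
    by (simp add: has_vector_derivative_def F'.scaleR)
  then have a: "partial_alpha F z = F' 1"
    unfolding partial_alpha_def by (rule vector_derivative_at)
  have "((\<lambda>t. Complex (Re z) t) has_vector_derivative \<i>) (at (Im z))"
    unfolding Complex_eq by (auto intro!: derivative_eq_intros simp: has_vector_derivative_def scaleR_conv_of_real)
  from has_derivative_compose[OF this[unfolded has_vector_derivative_def], of F F'] F'
  have "((\<lambda>t. F (Complex (Re z) t)) has_vector_derivative F' \<i>) (at (Im z))"
    by (simp add: has_vector_derivative_def F'.scaleR)
  then have b: "partial_beta F z = F' \<i>"
    unfolding partial_beta_def by (rule vector_derivative_at)
  have "F' 1 + octC_iota (F' \<i>) = 0"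
    using CR[OF assms] unfolding a b .
  then have "fst (F' 1) - snd (F' \<i>) = 0" "snd (F' 1) + fst (F' \<i>) = 0"
    by (simp_all add: octC_iota_def prod_eq_iff)
  then have "F' \<i> = octC_iota (F' 1)"
    by (simp add: octC_iota_def prod_eq_iff eq_neg_iff_add_eq_0 add.commute)
  with F' show ?thesis by (rule that)
qed

lemma continuous_on_F: "continuous_on D F"
proof (intro continuous_at_imp_continuous_on ballI)
  fix z assume "z \<in> D"
  then obtain F' where "(F has_derivative F') (at z)" by (rule differentiable)
  then show "isCont F z" by (rule has_derivative_continuous)
qed

definition stem_coord :: "oct \<Rightarrow> complex \<Rightarrow> complex" where
  "stem_coord e z = Complex (fst (F z) \<bullet> e) (snd (F z) \<bullet> e)"

lemma holomorphic_stem_coord: "stem_coord e holomorphic_on D"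
proof (rule holomorphic_onI)
  fix z assume "z \<in> D"
  then obtain F' where F': "(F has_derivative F') (at z)" "F' \<i> = octC_iota (F' 1)"
    by (rule differentiable)
  interpret F': bounded_linear F' using F'(1) by (rule has_derivative_bounded_linear)
  let ?c = "Complex (fst (F' 1) \<bullet> e) (snd (F' 1) \<bullet> e)"
  have "(stem_coord e has_derivative (\<lambda>h. of_real (fst (F' h) \<bullet> e) + \<i> * of_real (snd (F' h) \<bullet> e))) (at z)"
    unfolding stem_coord_def[abs_def] Complex_eq by (rule derivative_eq_intros F'(1) refl | simp)+
  moreover have "of_real (fst (F' h) \<bullet> e) + \<i> * of_real (snd (F' h) \<bullet> e) = ?c * h" for h
  proof -
    have "F' h = Re h *\<^sub>R F' 1 + Im h *\<^sub>R F' \<i>"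
      unfolding F'.scaleR[symmetric] F'.add[symmetric]
      by (rule arg_cong[of _ _ F']) (simp add: complex_eq_iff)
    then show ?thesis
      by (simp add: F'(2) octC_iota_def complex_eq_iff inner_add_left inner_diff_left algebra_simps)
  qed
  ultimately have "(stem_coord e has_field_derivative ?c) (at z)"
    by (simp add: has_field_derivative_def)
  then have "stem_coord e field_differentiable at z"
    unfolding field_differentiable_def by (rule exI)
  then show "stem_coord e field_differentiable at z within D"
    by (rule field_differentiable_at_within)
qed

section \<open>The functions N_y and the fibres over a single sphere\<close>

definition stem_normsq :: "oct \<Rightarrow> complex \<Rightarrow> complex" where
  "stem_normsq y z = complexified_normsq (F z - (y, 0))"

lemma stem_normsq_eq:
  "stem_normsq y z = (\<Sum>e\<in>Basis. (stem_coord e z - of_real (y \<bullet> e))\<^sup>2)"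
  unfolding stem_normsq_def complexified_normsq_eq_sum stem_coord_def
  by (intro sum.cong refl arg_cong[of _ _ "\<lambda>w. w\<^sup>2"]) (simp add: complex_eq_iff inner_diff_left)

lemma holomorphic_stem_normsq: "stem_normsq y holomorphic_on D"
  unfolding stem_normsq_eq[abs_def] by (intro holomorphic_intros holomorphic_stem_coord)

lemma stem_normsq_eq_0_iff:
  assumes "z \<in> D"
  shows "stem_normsq y z = 0 \<longleftrightarrow> (\<exists>J\<in>imag_units. f (slice_point z J) = y)"
  by (simp add: stem_normsq_def complexified_normsq_eq_0_iff f_slice_point[OF assms] diff_add_eq cong: bex_cong)

text \<open>The parameter y enters each coordinate only as an additive constant. Squaring preserves
  uniform convergence because the limit coordinates are bounded on the compact set.\<close>

lemma uniform_limit_stem_normsq: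
  assumes K: "compact K" "K \<subseteq> D" and Y: "Y \<longlonglongrightarrow> b"
  shows "uniform_limit K (\<lambda>n. stem_normsq (Y n)) (stem_normsq b) sequentially"
  unfolding stem_normsq_eq[abs_def]
proof (intro uniform_limit_sum)
  fix e :: oct
  have "compact (stem_coord e ` K)"
    by (intro compact_continuous_image K(1) holomorphic_on_imp_continuous_on
        holomorphic_on_subset[OF holomorphic_stem_coord K(2)])
  then have bd: "bounded (stem_coord e ` K)" by (rule compact_imp_bounded)
  have "(\<lambda>n. complex_of_real (Y n \<bullet> e)) \<longlonglongrightarrow> of_real (b \<bullet> e)"
    by (intro tendsto_intros Y)
  then have "uniform_limit K (\<lambda>n z. complex_of_real (Y n \<bullet> e)) (\<lambda>z. of_real (b \<bullet> e)) sequentially"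
    by (auto simp: uniform_limit_iff dest: tendstoD)
  then have lim: "uniform_limit K (\<lambda>n z. stem_coord e z - of_real (Y n \<bullet> e)) (\<lambda>z. stem_coord e z - of_real (b \<bullet> e)) sequentially"
    by (intro uniform_limit_minus uniform_limit_const)
  have "bounded ((\<lambda>z. stem_coord e z - of_real (b \<bullet> e)) ` K)"
    using bd by (intro bounded_minus_comp) (auto simp: image_constant_conv)
  then show "uniform_limit K (\<lambda>n z. (stem_coord e z - of_real (Y n \<bullet> e))\<^sup>2) (\<lambda>z. (stem_coord e z - of_real (b \<bullet> e))\<^sup>2) sequentially"
    unfolding power2_eq_square by (intro uniform_lim_mult lim)
qed

text \<open>On the sphere over z the map is J -> F_1 + J F_2. If F_2 = 0 it is constant and the
  whole connected sphere lies in one component; otherwise it is injective and the fibre has at most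
  one point there.\<close>

lemma fibre_sphere_subset:
  assumes C: "C \<in> components {x \<in> circularization D. f x = b}"
    and z: "z \<in> D" and J: "J \<in> imag_units" "slice_point z J \<in> C" and J': "J' \<in> imag_units" "f (slice_point z J') = b"
  shows "slice_point z J' \<in> C"
proof (cases "snd (F z) = 0")
  case True
  have fJ: "f (slice_point z J) = b" using C J in_components_subset by blast
  have "slice_point z ` imag_units \<subseteq> C"
  proof (rule components_maximal[OF C])
    show "connected (slice_point z ` imag_units)"
      unfolding slice_point_def[abs_def] by (intro connected_continuous_image continuous_intros connected_imag_units)
    show "slice_point z ` imag_units \<subseteq> {x \<in> circularization D. f x = b}"
      using fJ z J True by (auto simp: f_slice_point omult.zero_right slice_point_in_circularization)
    show "C \<inter> slice_point z ` imag_units \<noteq> {}" using J by blast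
  qed
  with J' show ?thesis by blast
next
  case False
  have "f (slice_point z J) = b" using C J in_components_subset by blast
  then have "J \<cdot>\<^sub>O snd (F z) = J' \<cdot>\<^sub>O snd (F z)"
    using J'(2) unfolding f_slice_point[OF z J(1)] f_slice_point[OF z J'(1)] by (metis add_left_imp_eq)
  then have "J = J'"
    by (rule omult_right_cancel[OF False])
  with J show ?thesis by simp
qed

section \<open>Openness where N_b is not identically zero, noncompact fibres where it is\<close>

lemma tendsto_slice_point:
  assumes "Z \<longlonglongrightarrow> z" "Js \<longlonglongrightarrow> J"
  shows "(\<lambda>n. slice_point (Z n) (Js n)) \<longlonglongrightarrow> slice_point z J"
  unfolding slice_point_def by (intro tendsto_intros assms)

lemma tendsto_f_slice_point:
  assumes "z \<in> D" "Z \<longlonglongrightarrow> z" "\<And>n. Z n \<in> D" "Js \<longlonglongrightarrow> J" "J \<in> imag_units" "\<And>n. Js n \<in> imag_units"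
  shows "(\<lambda>n. f (slice_point (Z n) (Js n))) \<longlonglongrightarrow> f (slice_point z J)"
proof -
  have "isCont F z"
    using continuous_on_F open_D assms(1) by (simp add: continuous_on_eq_continuous_at)
  then have "(\<lambda>n. F (Z n)) \<longlonglongrightarrow> F z"
    using assms(2) by (rule isCont_tendsto_compose)
  then show ?thesis
    unfolding f_slice_point[OF assms(1,5)] f_slice_point[OF assms(3,6)]
    by (intro tendsto_intros omult.tendsto assms)
qed

text \<open>Were all N_(Y n) zero-free on a ball around z0, Hurwitz's theorem would make N_b
  zero-free there as well.\<close>

lemma Hurwitz_stem_normsq:
  assumes E: "open E" "connected E" "E \<subseteq> D" and z0: "z0 \<in> E" "stem_normsq b z0 = 0"
    and nz: "w \<in> E" "stem_normsq b w \<noteq> 0" and Y: "Y \<longlonglongrightarrow> b" and U: "open U" "z0 \<in> U"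
  shows "\<exists>n. \<exists>z \<in> E \<inter> U. stem_normsq (Y n) z = 0"
proof (rule ccontr)
  assume none: "\<not> ?thesis"
  obtain r where r: "r > 0" "ball z0 r \<subseteq> E \<inter> U"
    using openE[of "E \<inter> U" z0] E U z0 by auto
  have sub: "ball z0 r \<subseteq> D" using r E by auto
  have "stem_normsq b z0 \<noteq> 0"
  proof (rule Hurwitz_no_zeros[of "ball z0 r" "\<lambda>n. stem_normsq (Y n)" "stem_normsq b"])
    \<comment> \<open>A constant value on the ball would be the value 0 at z0, and analytic
      continuation would spread it to w.\<close>
    show "\<not> stem_normsq b constant_on ball z0 r"
    proof
      assume "stem_normsq b constant_on ball z0 r"
      then have eq: "stem_normsq b z = 0" if "z \<in> ball z0 r" for z
        using that z0(2) r(1) unfolding constant_on_def by (metis centre_in_ball)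
      have "stem_normsq b w = 0"
      proof (rule analytic_continuation_open[of "ball z0 r" E "stem_normsq b" "\<lambda>_. 0"])
        show "stem_normsq b holomorphic_on E" by (rule holomorphic_on_subset[OF holomorphic_stem_normsq E(3)])
      qed (use r E nz eq in auto)
      with nz show False by simp
    qed
    show "uniform_limit K (\<lambda>n. stem_normsq (Y n)) (stem_normsq b) sequentially" if "compact K" "K \<subseteq> ball z0 r" for K
      using that sub Y by (intro uniform_limit_stem_normsq) auto
    show "stem_normsq (Y n) z \<noteq> 0" if "z \<in> ball z0 r" for n z
      using none that r by blast
  qed (use r in \<open>auto intro: holomorphic_on_subset[OF holomorphic_stem_normsq sub]\<close>)
  with z0 show False by simp
qed

text \<open>Otherwise values Y n missed by the image tend to b. Zeros of N_(Y n) near z0 give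
  preimages whose units subconverge; the limit lies in the fibre over z0, hence in U, so some
  preimage lies in U too.\<close>

lemma interior_image:
  assumes E: "open E" "connected E" "E \<subseteq> D" and z0: "z0 \<in> E" "stem_normsq b z0 = 0"
    and nz: "w \<in> E" "stem_normsq b w \<noteq> 0"
    and U: "open U" "\<And>J. J \<in> imag_units \<Longrightarrow> f (slice_point z0 J) = b \<Longrightarrow> slice_point z0 J \<in> U"
  shows "b \<in> interior (f ` (circularization D \<inter> U))" (is "_ \<in> interior ?A")
proof (rule ccontr)
  assume "b \<notin> interior ?A"
  then have "b \<in> closure (- ?A)" by (simp add: closure_complement)
  then obtain Y where Y: "\<And>n. Y n \<notin> ?A" "Y \<longlonglongrightarrow> b"
    unfolding closure_sequential by auto
  have "\<exists>n z J. n \<ge> k \<and> z \<in> E \<and> dist z z0 < inverse (real (Suc k)) \<and> J \<in> imag_units \<and> f (slice_point z J) = Y n" for k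
  proof -
    have "\<exists>n. \<exists>z \<in> E \<inter> ball z0 (inverse (real (Suc k))). stem_normsq (Y (n + k)) z = 0"
      \<comment> \<open>The Hurwitz lemma yields only one index; applying it to the sequence shifted
        by k makes that index at least k.\<close>
      by (rule Hurwitz_stem_normsq[OF E z0 nz LIMSEQ_ignore_initial_segment[OF Y(2)]]) auto
    then obtain n z where "z \<in> E" "dist z z0 < inverse (real (Suc k))" "stem_normsq (Y (n + k)) z = 0"
      by (auto simp: dist_commute)
    then show ?thesis
      using E(3) stem_normsq_eq_0_iff[of z "Y (n + k)"] by (meson le_add2 subsetD)
  qed
  then obtain n Z Js where n: "\<And>k. n k \<ge> k" and Z: "\<And>k. Z k \<in> E" "\<And>k. dist (Z k) z0 < inverse (real (Suc k))"
    and Js: "\<And>k. Js k \<in> imag_units" and eq: "\<And>k. f (slice_point (Z k) (Js k)) = Y (n k)"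
    by metis
  obtain J r where J: "J \<in> imag_units" and r: "strict_mono r" "(Js \<circ> r) \<longlonglongrightarrow> J"
    using compact_imag_units Js unfolding compact_def by metis
  have "Z \<longlonglongrightarrow> z0"
  proof (rule metric_LIMSEQ_I)
    fix e :: real assume "e > 0"
    then obtain m where m: "inverse (real (Suc m)) < e" using reals_Archimedean by blast
    have "dist (Z k) z0 < e" if "k \<ge> m" for k
    proof -
      have "inverse (real (Suc k)) \<le> inverse (real (Suc m))" using that by (simp add: field_simps)
      with Z(2)[of k] m show ?thesis by linarith
    qed
    then show "\<exists>m. \<forall>k\<ge>m. dist (Z k) z0 < e" by blast
  qed
  then have Zr: "(Z \<circ> r) \<longlonglongrightarrow> z0" using r(1) by (rule LIMSEQ_subseq_LIMSEQ)
  have "(\<lambda>k. f (slice_point ((Z \<circ> r) k) ((Js \<circ> r) k))) \<longlonglongrightarrow> f (slice_point z0 J)"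
    using Z Js E(3) z0 by (intro tendsto_f_slice_point Zr r J) auto
  moreover have "(\<lambda>k. f (slice_point ((Z \<circ> r) k) ((Js \<circ> r) k))) \<longlonglongrightarrow> b"
  proof -
    have "filterlim (\<lambda>k. n (r k)) sequentially sequentially"
      by (rule filterlim_at_top_mono[OF filterlim_subseq[OF r(1)]]) (simp add: n)
    from filterlim_compose[OF Y(2) this] show ?thesis by (simp add: eq)
  qed
  ultimately have "f (slice_point z0 J) = b" by (rule LIMSEQ_unique)
  then have "slice_point z0 J \<in> U" by (rule U(2)[OF J])
  from topological_tendstoD[OF tendsto_slice_point[OF Zr r(2)] U(1) this]
  obtain k where "slice_point (Z (r k)) (Js (r k)) \<in> U"
    unfolding eventually_sequentially o_def by blast
  moreover have "slice_point (Z (r k)) (Js (r k)) \<in> circularization D"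
    using Z Js E(3) by (intro slice_point_in_circularization) auto
  ultimately have "Y (n (r k)) \<in> ?A" unfolding eq[symmetric] by blast
  with Y(1) show False by blast
qed

text \<open>Every component of the fibre contains the graph of the unit -x y^(-1) over the dense set
  E - T. If it were compact, its projection by \<open>slice_coord\<close> would be all of E, a
  nonempty open set of the plane, which is not compact.\<close>

lemma fibre_component_not_compact:
  assumes E: "open E" "connected E" "E \<subseteq> D" "\<And>z. z \<in> E \<Longrightarrow> Im z > 0"
    and covers: "\<And>x. x \<in> circularization D \<Longrightarrow> slice_coord x \<in> E"
    and zero: "\<And>z. z \<in> E \<Longrightarrow> stem_normsq b z = 0"
    and T: "countable T" "\<And>z. z \<in> E - T \<Longrightarrow> snd (F z) \<noteq> 0"
    and C: "C \<in> components {x \<in> circularization D. f x = b}"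
  shows "\<not> compact C"
proof
  assume "compact C"
  \<comment> \<open>\<open>u\<close> is the unit solving x + Jy = 0, so that \<open>g\<close> is a
    continuous section of the fibre over E - T.\<close>
  define u where "u w = (- inverse ((norm (snd w))\<^sup>2)) *\<^sub>R (fst w \<cdot>\<^sub>O ocnj (snd w))" for w
  define g where "g z = slice_point z (u (F z - (b, 0)))" for z
  have u: "u (F z - (b, 0)) \<in> imag_units" "f (g z) = b" if "z \<in> E - T" for z
  proof -
    have c: "complexified_normsq (F z - (b, 0)) = 0" using zero that by (simp add: stem_normsq_def)
    have s: "snd (F z - (b, 0)) \<noteq> 0" using T(2) that by simp
    show 1: "u (F z - (b, 0)) \<in> imag_units"
      unfolding u_def by (rule complexified_normsq_zero_unit(1)[OF c s])
    have "fst (F z - (b, 0)) + u (F z - (b, 0)) \<cdot>\<^sub>O snd (F z - (b, 0)) = 0"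
      unfolding u_def by (rule complexified_normsq_zero_unit(2)[OF c s])
    moreover have "f (g z) = fst (F z) + u (F z - (b, 0)) \<cdot>\<^sub>O snd (F z)"
      unfolding g_def using E(3) that 1 by (intro f_slice_point) auto
    ultimately show "f (g z) = b" by (simp add: diff_add_eq)
  qed
  let ?L = "g ` (E - T)" and ?P = "{x \<in> circularization D. f x = b}"
  have L_P: "?L \<subseteq> ?P"
    using u E(3) by (auto simp: g_def intro!: slice_point_in_circularization)
  have "connected ?L"
  proof (rule connected_continuous_image)
    have "continuous_on (E - T) (\<lambda>z. u (F z - (b, 0)))"
      unfolding u_def
      by (rule continuous_on_compose2[OF continuous_on_zero_unit])
         (use E(3) T(2) in \<open>auto intro!: continuous_intros continuous_on_subset[OF continuous_on_F]\<close>)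
    then show "continuous_on (E - T) g"
      unfolding g_def slice_point_def by (intro continuous_intros)
    show "connected (E - T)"
      by (rule connected_open_diff_countable) (use E T in auto)
  qed
  obtain x0 where x0: "x0 \<in> C" using in_components_nonempty[OF C] by blast
  then have x0P: "x0 \<in> ?P" using in_components_subset[OF C] by blast
  obtain J0 where J0: "J0 \<in> imag_units" "x0 = slice_point (slice_coord x0) J0" by (rule slice_point_slice_coordE)
  define z0 where "z0 = slice_coord x0"
  have z0: "z0 \<in> E" using x0P covers by (simp add: z0_def)
  then have "z0 \<in> closure (E - T)" using closure_open_diff_countable[OF E(1) T(1)] by blast
  \<comment> \<open>The base point z0 of C may lie in T, so it is approached from E - T; a limit of
    the units there gives a point of the fibre over z0 in the closure of the graph.\<close>
  then obtain Z where Z: "\<And>n. Z n \<in> E - T" "Z \<longlonglongrightarrow> z0"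
    unfolding closure_sequential by blast
  obtain J r where J: "J \<in> imag_units" and r: "strict_mono r" "((\<lambda>n. u (F (Z n) - (b, 0))) \<circ> r) \<longlonglongrightarrow> J"
    using compact_imag_units u(1)[OF Z(1)] unfolding compact_def by metis
  have Zr: "(Z \<circ> r) \<longlonglongrightarrow> z0" using Z(2) r(1) by (rule LIMSEQ_subseq_LIMSEQ)
  have lim: "(\<lambda>n. g (Z (r n))) \<longlonglongrightarrow> slice_point z0 J"
    using tendsto_slice_point[OF Zr r(2)] by (simp add: g_def)
  have "(\<lambda>n. f (g (Z (r n)))) \<longlonglongrightarrow> f (slice_point z0 J)"
    using tendsto_f_slice_point[OF _ Zr _ r(2) J] z0 E(3) Z(1) u(1)[OF Z(1)] by (simp add: g_def subset_iff)
  then have fJ: "f (slice_point z0 J) = b"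
    using u(2)[OF Z(1)] by (simp add: LIMSEQ_const_iff)
  have J_C: "slice_point z0 J \<in> C"
  proof (rule fibre_sphere_subset[OF C _ J0(1) _ J fJ])
    show "z0 \<in> D" using z0 E(3) by blast
    show "slice_point z0 J0 \<in> C" using x0 J0(2) by (simp add: z0_def)
  qed
  have "slice_point z0 J \<in> closure ?L"
    unfolding closure_sequential using lim Z(1) by (intro exI[of _ "\<lambda>n. g (Z (r n))"]) auto
  \<comment> \<open>The limit point lies in C and adding it keeps the graph connected, so the graph
    lies in the same component C.\<close>
  then have "connected (insert (slice_point z0 J) ?L)"
    by (intro connected_intermediate_closure[OF \<open>connected ?L\<close>]) (auto intro: subsetD[OF closure_subset])
  moreover have "insert (slice_point z0 J) ?L \<subseteq> ?P"
    using L_P J_C in_components_subset[OF C] by blast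
  ultimately have L_C: "?L \<subseteq> C"
    using components_maximal[OF C, of "insert (slice_point z0 J) ?L"] J_C by blast
  have "slice_coord (g z) = z" if "z \<in> E - T" for z
    using u(1)[OF that] E(4)[of z] that by (simp add: g_def slice_coord_slice_point)
  then have "E - T \<subseteq> slice_coord ` C"
    using L_C by (force simp: image_iff)
  moreover have cpt: "compact (slice_coord ` C)"
    by (intro compact_continuous_image continuous_on_slice_coord \<open>compact C\<close>)
  ultimately have "closure (E - T) \<subseteq> slice_coord ` C"
    by (intro closure_minimal compact_imp_closed)
  with closure_open_diff_countable[OF E(1) T(1)] have "E \<subseteq> slice_coord ` C" by blast
  moreover have "slice_coord ` C \<subseteq> E" using covers in_components_subset[OF C] by blast
  ultimately have "slice_coord ` C = E" by (intro subset_antisym)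
  then have "compact E" using cpt by simp
  with E(1) z0 show False using compact_open[of E] by auto
qed

text \<open>Treats both kinds of domain at once: E is the whole base of a slice domain, or the upper
  component of the base of a product domain.\<close>

lemma quasi_open:
  assumes E: "open E" "connected E" "E \<subseteq> D" "E \<inter> \<real> \<noteq> {} \<or> (\<forall>z\<in>E. Im z > 0)"
    and covers: "\<And>x. x \<in> circularization D \<Longrightarrow> slice_coord x \<in> E"
    and nonconst: "\<not> f constant_on circularization D"
  shows "quasi_open_map (top_of_set (circularization D)) euclidean f"
  unfolding quasi_open_map_def
proof (intro conjI ballI allI impI)
  fix b C U
  let ?P = "{x \<in> circularization D. f x = b}"
  assume "C \<in> connected_components_of
           (subtopology (top_of_set (circularization D)) {x \<in> topspace (top_of_set (circularization D)). f x = b})"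
  then have "C \<in> connected_components_of (top_of_set ?P)"
    by (simp add: subtopology_subtopology Collect_conj_eq)
  then have C: "C \<in> components ?P" by (simp add: connected_components_of_top_of_set)
  assume "compactin (top_of_set (circularization D)) C"
  then have "compact C" by (simp add: compactin_subtopology)
  assume "openin (top_of_set (circularization D)) U \<and> C \<subseteq> U"
  then obtain V where V: "open V" "U = circularization D \<inter> V" "C \<subseteq> U"
    by (auto simp: openin_open)
  obtain x0 where x0: "x0 \<in> C" using in_components_nonempty[OF C] by blast
  then have x0P: "x0 \<in> ?P" using in_components_subset[OF C] by blast
  obtain J0 where J0: "J0 \<in> imag_units" "x0 = slice_point (slice_coord x0) J0" by (rule slice_point_slice_coordE)
  define z0 where "z0 = slice_coord x0"
  have "x0 \<in> circularization D" using x0P by blast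
  then have z0E: "z0 \<in> E" unfolding z0_def by (rule covers)
  then have z0: "z0 \<in> D" using E(3) by blast
  have x0_eq: "slice_point z0 J0 = x0" using J0(2) by (simp add: z0_def)
  have "\<exists>w\<in>E. stem_normsq b w \<noteq> 0"
  proof (rule ccontr)
    assume "\<not> ?thesis"
    then have zero: "\<And>z. z \<in> E \<Longrightarrow> stem_normsq b z = 0" by blast
    obtain x where x: "x \<in> circularization D" "f x \<noteq> b"
      using nonconst unfolding constant_on_def by blast
    obtain J where J: "J \<in> imag_units" "x = slice_point (slice_coord x) J" by (rule slice_point_slice_coordE)
    have xE: "slice_coord x \<in> E" using covers x by blast
    then have xD: "slice_coord x \<in> D" using E(3) by blast
    \<comment> \<open>If every coordinate of F agreed with that of b over x, then F = (b, 0) there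
      and f x = b, against the choice of x.\<close>
    obtain e where e: "stem_coord e (slice_coord x) \<noteq> of_real (b \<bullet> e)"
    proof (rule ccontr)
      assume "\<not> thesis"
      then have "stem_coord e (slice_coord x) = of_real (b \<bullet> e)" for e
        using that by blast
      then have "fst (F (slice_coord x)) \<bullet> e = b \<bullet> e" "snd (F (slice_coord x)) \<bullet> e = 0 \<bullet> e" for e
        by (auto simp: stem_coord_def complex_eq_iff)
      then have "fst (F (slice_coord x)) = b" "snd (F (slice_coord x)) = 0"
        using euclidean_eqI[of "fst (F (slice_coord x))" b] euclidean_eqI[of "snd (F (slice_coord x))" 0] by blast+
      then have "f x = b"
        using f_slice_point[OF xD J(1)] J(2) by (simp add: omult.zero_right)
      with x(2) show False by blast
    qed
    define T where "T = {z \<in> E. stem_coord e z - of_real (b \<bullet> e) = 0}"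
    have T: "countable T"
      unfolding T_def
      by (rule countable_zeros_open[of _ E "slice_coord x"])
         (use e E xE in \<open>auto intro!: holomorphic_intros holomorphic_on_subset[OF holomorphic_stem_coord]\<close>)
    \<comment> \<open>When F_2(z) = 0, N_b(z) is |F_1(z) - b|^2; its vanishing gives F(z) = (b, 0),
      which puts z in T.\<close>
    have snd_F: "snd (F z) \<noteq> 0" if "z \<in> E - T" for z
    proof
      assume s: "snd (F z) = 0"
      then have "fst (F z) = b"
        using zero[of z] that by (simp add: stem_normsq_def complexified_normsq_def s complex_eq_iff)
      with s that show False by (auto simp: T_def stem_coord_def complex_eq_iff)
    qed
    show False
    proof (cases "E \<inter> \<real> = {}")
      case True
      with E have "\<And>z. z \<in> E \<Longrightarrow> Im z > 0" by blast
      from fibre_component_not_compact[OF E(1-3) this covers zero T snd_F C] \<open>compact C\<close>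
      show False by blast
    next
      case False
      then obtain t where t: "complex_of_real t \<in> E" unfolding Reals_def by blast
      \<comment> \<open>The real trace of E is open and nonempty, so it has a point outside the
        countable T; there F_2 is nonzero, whereas the stem symmetry forces F_2 = 0 at real
        points.\<close>
      have "open (complex_of_real -` E)"
        by (intro open_vimage E continuous_intros)
      moreover have "countable (complex_of_real -` T)"
        by (rule countable_image_inj_on[of complex_of_real])
           (auto intro: countable_subset[OF _ T] simp: inj_on_def)
      ultimately obtain s where "complex_of_real s \<in> E" "complex_of_real s \<notin> T"
        using open_minus_countable[of "complex_of_real -` T" "complex_of_real -` E"] t by auto
      then have s: "complex_of_real s \<in> E - T" "complex_of_real s \<in> D" using E(3) by auto
      have "F (cnj (complex_of_real s)) = octC_cnj (F (complex_of_real s))"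
        using stem s(2) unfolding is_stem_def by blast
      then have "snd (F (complex_of_real s)) = 0"
        by (simp add: octC_cnj_def prod_eq_iff)
      with snd_F[OF s(1)] show False by contradiction
    qed
  qed
  then obtain w where w: "w \<in> E" "stem_normsq b w \<noteq> 0" by blast
  have "stem_normsq b z0 = 0"
    unfolding stem_normsq_eq_0_iff[OF z0] using J0(1) x0_eq x0P by blast
  moreover have "slice_point z0 J \<in> V" if "J \<in> imag_units" "f (slice_point z0 J) = b" for J
    using fibre_sphere_subset[OF C z0 J0(1) _ that] x0 V unfolding x0_eq by blast
  ultimately have "b \<in> interior (f ` (circularization D \<inter> V))"
    using E(1-3) z0E w V(1) by (intro interior_image) auto
  then show "b \<in> euclidean interior_of f ` U"
    by (simp add: V(2))
qed simp

end

section \<open>Reduction of slice and product domains to a connected set E\<close>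

theorem theorem5p6:
  fixes \<Omega> :: "oct set" and f :: "oct \<Rightarrow> oct"
  assumes "is_slice_domain \<Omega> \<or> is_product_domain \<Omega>"
    and "slice_regular_on \<Omega> f"
    and "\<not> slice_constant_on \<Omega> f"
  shows "quasi_open_map (top_of_set \<Omega>) euclidean f"
proof -
  obtain D F where \<Omega>: "\<Omega> = circularization D" and stem: "slice_regular_stem D F f"
    using assms(2) unfolding slice_regular_on_def slice_regular_stem_def by blast
  interpret slice_regular_stem D F f by (rule stem)
  \<comment> \<open>A constant f is constant on every subset, hence slice constant.\<close>
  have nonconst: "\<not> f constant_on circularization D"
  proof
    assume const: "f constant_on circularization D"
    have "slice_constant_on \<Omega> f"
      unfolding slice_constant_on_def locally_def \<Omega>
      using constant_on_subset[OF const] openin_imp_subset by (meson Int_lower1 order_trans order_refl)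
    with assms(3) show False ..
  qed
  from assms(1) show ?thesis
  proof
    assume "is_slice_domain \<Omega>"
    then obtain D' where D': "circular_domain_base D'" "\<Omega> = circularization D'" "connected D'" "D' \<inter> \<real> \<noteq> {}"
      unfolding is_slice_domain_def by blast
    have "D' = D"
      by (rule circularization_inj) (use D' cnj_D \<Omega> in \<open>auto simp: circular_domain_base_def\<close>)
    then show ?thesis
      unfolding \<Omega> using D' nonconst
      by (intro quasi_open[of D] open_D) (auto simp: mem_circularization[OF cnj_D])
  next
    assume "is_product_domain \<Omega>"
    then obtain D' A A' where D': "circular_domain_base D'" "\<Omega> = circularization D'" "D' \<inter> \<real> = {}"
      and A: "components D' = {A, A'}" "A \<noteq> A'" "cnj ` A = A'" "cnj ` A' = A"
      unfolding is_product_domain_def by (elim exE conjE) (rule that)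
    have "D' = D"
      by (rule circularization_inj) (use D' cnj_D \<Omega> in \<open>auto simp: circular_domain_base_def\<close>)
    note D' = D'[unfolded this] and A = A[unfolded this]
    have D_eq: "D = A \<union> A'" using Union_components[of D] unfolding A(1) by simp
    have comps: "A \<in> components D" "A' \<in> components D" unfolding A(1) by simp_all
    \<comment> \<open>Each component avoids the real line, so it lies in one open half plane;
      conjugation puts the other component in the opposite one.\<close>
    have "\<exists>E\<in>components D. (\<forall>z\<in>E. Im z > 0) \<and> (\<forall>z\<in>D - E. Im z < 0)"
    proof -
      have "A \<inter> \<real> = {}" using D' D_eq by blast
      then consider "\<forall>z\<in>A. Im z > 0" | "\<forall>z\<in>A. Im z < 0"
        using connected_avoiding_reals in_components_connected[OF comps(1)] by blast
      then show ?thesis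
      proof cases
        case 1
        with A(3) have "\<forall>z\<in>A'. Im z < 0" by auto
        with 1 comps D_eq show ?thesis by (intro bexI[of _ A]) auto
      next
        case 2
        with A(3) have "\<forall>z\<in>A'. Im z > 0" by auto
        with 2 comps D_eq show ?thesis by (intro bexI[of _ A']) auto
      qed
    qed
    then obtain E where E: "E \<in> components D" "\<forall>z\<in>E. Im z > 0" "\<forall>z\<in>D - E. Im z < 0" by blast
    show ?thesis
      unfolding \<Omega>
    proof (rule quasi_open[of E])
      show "open E" by (rule open_components[OF open_D E(1)])
      show "connected E" by (rule in_components_connected[OF E(1)])
      show "E \<subseteq> D" by (rule in_components_subset[OF E(1)])
      show "E \<inter> \<real> \<noteq> {} \<or> (\<forall>z\<in>E. Im z > 0)" using E(2) by blast
      \<comment> \<open>\<open>slice_coord x\<close> has nonnegative imaginary part and so cannot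
        lie in the lower component.\<close>
      show "slice_coord x \<in> E" if "x \<in> circularization D" for x
        using that E(3) Im_slice_coord_nonneg[of x] by (force simp: mem_circularization[OF cnj_D])
    qed (rule nonconst)
  qed
qed

end
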